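(* Let $\mathbb{F}_q$ be the finite field with $q$ elements, let $n$ be a positive integer, and let $X$ be a set with at most $\frac{q^{n+1}-q}{q-1}$ elements. If $f_1,\ldots,f_k \in \mathrm{Map}(X,\mathbb{F}_q)$ for some integer $k>n$, then there exist $g_1,\ldots,g_n \in \mathrm{Span}(f_1,\ldots,f_k)$ such that $\mathrm{Z}(g_1,\ldots,g_n)=\mathrm{Z}(f_1,\ldots,f_k)$.
   Context: For a set $X$, $\mathrm{Map}(X,\mathbb{F}_q)$ denotes the $\mathbb{F}_q$-vector space of all functions $f\colon X\to\mathbb{F}_q$ (with pointwise operations). For $f_1,\ldots,f_k\in\mathrm{Map}(X,\mathbb{F}_q)$, $\mathrm{Z}(f_1,\ldots,f_k)=\{x\in X : f_1(x)=\cdots=f_k(x)=0\}$ is the set of common zeros, and $\mathrm{Span}(f_1,\ldots,f_k)$ is the $\mathbb{F}_q$-linear subspace of $\mathrm{Map}(X,\mathbb{F}_q)$ generated by $f_1,\ldots,f_k$. *)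

theory Defs
  imports Complex_Main "HOL-Library.Cardinality" "HOL-Library.Function_Algebras"
    "HOL-Library.FuncSet"
begin

text \<open>
  A function on the set \<open>X\<close> is represented by its extension by zero to the whole type, so that
  functions on \<open>X\<close> are equal iff they agree on \<open>X\<close>, and the pointwise operations on the full
  function type restrict to those of \<open>Map(X, F)\<close>.
\<close>

definition Map_on :: "'x set \<Rightarrow> ('x \<Rightarrow> 'a::zero) set"
  where "Map_on X = {f. \<forall>x. x \<notin> X \<longrightarrow> f x = 0}"

definition scale_fun :: "'a::field \<Rightarrow> ('x \<Rightarrow> 'a) \<Rightarrow> 'x \<Rightarrow> 'a"
  where "scale_fun c f = (\<lambda>x. c * f x)"

interpretation fun_space: vector_space "scale_fun :: 'a::field \<Rightarrow> ('x \<Rightarrow> 'a) \<Rightarrow> 'x \<Rightarrow> 'a"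
  by unfold_locales (simp_all add: scale_fun_def fun_eq_iff algebra_simps)

lemma subspace_Map_on: "fun_space.subspace (Map_on X)"
  by (simp add: fun_space.subspace_def Map_on_def scale_fun_def)

lemma span_subset_Map_on: "F \<subseteq> Map_on X \<Longrightarrow> fun_space.span F \<subseteq> Map_on X"
  by (rule fun_space.span_minimal[OF _ subspace_Map_on])

lemma bij_betw_restrict_Map_on:
  "bij_betw (\<lambda>f. restrict f X) (Map_on X) (X \<rightarrow>\<^sub>E (UNIV :: 'a::zero set))"
  by (rule bij_betw_byWitness[where f' = "\<lambda>g x. if x \<in> X then g x else 0"])
    (auto simp: Map_on_def fun_eq_iff PiE_def extensional_def)

definition common_zeros :: "'x set \<Rightarrow> nat \<Rightarrow> (nat \<Rightarrow> 'x \<Rightarrow> 'a::zero) \<Rightarrow> 'x set"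
  where "common_zeros X k f = {x \<in> X. \<forall>i\<in>{1..k}. f i x = 0}"

end

theory Submission imports Defs begin

text \<open>
  View each \<open>x \<in> X\<close> as the point \<open>(f 1 x, \<dots>, f k x)\<close> of \<open>F ^ k\<close>. The hypothesis on \<open>card X\<close> says that
  \<open>X\<close> has fewer elements than the projective space of dimension \<open>n\<close>, so for \<open>k > n\<close> some line
  of \<open>F ^ k\<close> contains no point of \<open>X\<close> except possibly the origin. Projecting along this line
  replaces \<open>f 1, \<dots>, f k\<close> by \<open>k - 1\<close> linear combinations with the same common zeros; iterate until
  \<open>k = n\<close>.
\<close>

text \<open>By counting: the origin and the nonzero multiples of the points \<open>v x\<close> do
  not exhaust the vectors indexed by \<open>I\<close>. A vector \<open>w\<close> outside them spans
  a line that meets the points at most in the origin.\<close>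

lemma exists_line_avoiding:
  fixes v :: "'x \<Rightarrow> 'i \<Rightarrow> 'a::{field,finite}"
  assumes "finite X" and "finite I"
    and card: "card X * (CARD('a) - 1) + 1 < CARD('a) ^ card I"
  obtains w j where "j \<in> I" and "w j \<noteq> 0"
    and "\<And>x c. x \<in> X \<Longrightarrow> \<exists>i\<in>I. w i \<noteq> c * v x i"
proof -
  \<comment> \<open>The origin is inserted once, instead of once per point through
    \<open>c = 0\<close>; this gives the bound \<open>card X * (CARD('a) - 1) + 1\<close>.\<close>
  define B where "B = insert (\<lambda>i\<in>I. 0) ((\<lambda>(x, c). \<lambda>i\<in>I. c * v x i) ` (X \<times> (UNIV - {0})))"
  have fin: "finite B"
    using \<open>finite X\<close> by (simp add: B_def)
  have "card B \<le> Suc (card ((\<lambda>(x, c). \<lambda>i\<in>I. c * v x i) ` (X \<times> (UNIV - {0}))))"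
    unfolding B_def by (rule card_insert_le_m1) simp_all
  also have "\<dots> \<le> Suc (card (X \<times> (UNIV - {0 :: 'a})))"
    using card_image_le[of "X \<times> (UNIV - {0 :: 'a})"] \<open>finite X\<close> by simp
  also have "\<dots> < card (I \<rightarrow>\<^sub>E (UNIV :: 'a set))"
    using card \<open>finite I\<close> by (simp add: card_cartesian_product card_PiE)
  finally have "\<not> (I \<rightarrow>\<^sub>E UNIV) \<subseteq> B"
    using card_mono[OF fin] by (meson not_less)
  then obtain w where w: "w \<in> I \<rightarrow>\<^sub>E UNIV" "w \<notin> B"
    by blast
  have restr: "w = (\<lambda>i\<in>I. u i)" if "\<forall>i\<in>I. w i = u i" for u
    using w(1) that by (intro extensionalityI[of _ I]) (auto simp: PiE_def)
  obtain j where "j \<in> I" "w j \<noteq> 0"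
    using restr[of "\<lambda>_. 0"] w(2) by (auto simp: B_def)
  moreover have "\<exists>i\<in>I. w i \<noteq> c * v x i" if "x \<in> X" for x c
  proof (rule ccontr)
    assume "\<not> (\<exists>i\<in>I. w i \<noteq> c * v x i)"
    then have eq: "\<forall>i\<in>I. w i = c * v x i"
      by blast
    then have "c \<noteq> 0"
      using \<open>j \<in> I\<close> \<open>w j \<noteq> 0\<close> by auto
    then have "w \<in> B"
      using restr[OF eq] that unfolding B_def
      by (intro insertI2 image_eqI[of _ _ "(x, c)"]) auto
    then show False
      using w(2) by blast
  qed
  ultimately show thesis
    using that by blast
qed

lemma common_zeros_drop_one:
  fixes f :: "nat \<Rightarrow> 'x \<Rightarrow> 'a::{field,finite}"
  assumes "finite X" and "card X * (CARD('a) - 1) + 1 < CARD('a) ^ Suc k"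
  obtains g where "g ` {1..k} \<subseteq> fun_space.span (f ` {1..Suc k})"
    and "common_zeros X k g = common_zeros X (Suc k) f"
proof -
  let ?I = "{1..Suc k}"
  obtain w j where j: "j \<in> ?I" "w j \<noteq> 0"
    and w: "\<And>x c. x \<in> X \<Longrightarrow> \<exists>i\<in>?I. w i \<noteq> c * f i x"
    by (rule exists_line_avoiding[of X ?I "\<lambda>x i. f i x"]) (use assms in auto)
  define h where "h i = f i - scale_fun (w i / w j) (f j)" for i
  \<comment> \<open>Renumbering of the \<open>h i\<close> with \<open>i\<close> different from
    \<open>j\<close>: the free slot \<open>j\<close> receives \<open>h (Suc k)\<close>. If
    \<open>j = Suc k\<close>, nothing moves.\<close>
  define g where "g i = h (if i = j then Suc k else i)" for i
  have g_image: "g ` {1..k} = h ` (?I - {j})"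
  proof -
    have "(\<lambda>i. if i = j then Suc k else i) ` {1..k} = ?I - {j}"
      using j(1) by (auto simp: image_iff le_Suc_eq)
    moreover have "g ` {1..k} = h ` (\<lambda>i. if i = j then Suc k else i) ` {1..k}"
      by (simp only: image_image g_def[symmetric])
    ultimately show ?thesis by simp
  qed
  have "h i \<in> fun_space.span (f ` ?I)" if "i \<in> ?I" for i
    unfolding h_def using that j(1)
    by (intro fun_space.span_diff fun_space.span_scale fun_space.span_base imageI)
  then have "g ` {1..k} \<subseteq> fun_space.span (f ` ?I)"
    unfolding g_image by blast
  moreover have "(\<forall>i\<in>{1..k}. g i x = 0) \<longleftrightarrow> (\<forall>i\<in>?I. f i x = 0)" if "x \<in> X" for x
  proof
    assume "\<forall>i\<in>{1..k}. g i x = 0"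
    then have "\<forall>p\<in>h ` (?I - {j}). p x = 0"
      unfolding g_image[symmetric] by blast
    then have "\<forall>i\<in>?I. h i x = 0"
      using j(2) by (auto simp: h_def scale_fun_def)
    then have eq: "\<forall>i\<in>?I. f i x * w j = w i * f j x"
      using j(2) by (simp add: h_def scale_fun_def field_simps)
    \<comment> \<open>By \<open>eq\<close> the point of \<open>x\<close> is
      \<open>f j x / w j\<close> times \<open>w\<close>; were this factor nonzero, \<open>w\<close>
      would be a multiple of that point.\<close>
    have "f j x = 0"
    proof (rule ccontr)
      assume "f j x \<noteq> 0"
      then have "\<forall>i\<in>?I. w i = (w j / f j x) * f i x"
        using eq by (simp add: field_simps)
      then show False
        using w[OF that] by blast
    qed
    then show "\<forall>i\<in>?I. f i x = 0"
      using eq j(2) by simp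
  next
    assume *: "\<forall>i\<in>?I. f i x = 0"
    then have "\<forall>p\<in>h ` (?I - {j}). p x = 0"
      using j(1) by (auto simp: h_def scale_fun_def)
    then show "\<forall>i\<in>{1..k}. g i x = 0"
      unfolding g_image[symmetric] by blast
  qed
  then have "common_zeros X k g = common_zeros X (Suc k) f"
    unfolding common_zeros_def by blast
  ultimately show thesis
    by (rule that)
qed

lemma common_zeros_reduce:
  fixes f :: "nat \<Rightarrow> 'x \<Rightarrow> 'a::{field,finite}"
  assumes "finite X" and card: "card X * (CARD('a) - 1) + 1 < CARD('a) ^ Suc n"
    and "n \<le> k"
  shows "\<exists>g. g ` {1..n} \<subseteq> fun_space.span (f ` {1..k}) \<and>
    common_zeros X n g = common_zeros X k f"
  using \<open>n \<le> k\<close>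
proof (induction k arbitrary: f rule: dec_induct)
  case base
  then show ?case
    using fun_space.span_superset by blast
next
  case (step k)
  have "CARD('a) ^ Suc n \<le> CARD('a) ^ Suc k"
    using step.hyps by (intro power_increasing) (simp_all add: Suc_le_eq)
  then obtain h where h: "h ` {1..k} \<subseteq> fun_space.span (f ` {1..Suc k})"
    "common_zeros X k h = common_zeros X (Suc k) f"
    using common_zeros_drop_one[of X k f] \<open>finite X\<close> card by (metis order_less_le_trans)
  obtain g where g: "g ` {1..n} \<subseteq> fun_space.span (h ` {1..k})"
    "common_zeros X n g = common_zeros X k h"
    using step.IH by blast
  have "fun_space.span (h ` {1..k}) \<subseteq> fun_space.span (f ` {1..Suc k})"
    using h(1) by (intro fun_space.span_minimal fun_space.subspace_span)
  then show ?case
    using g h(2) by auto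
qed

theorem theorem1:
  fixes X :: "'x set" and f :: "nat \<Rightarrow> 'x \<Rightarrow> 'a::{field,finite}" and q n k :: nat
  assumes "q = CARD('a)"
    and "n \<ge> 1"
    and "finite X"
    and "real (card X) \<le> (real q ^ (n + 1) - real q) / (real q - 1)"
    and "k > n"
    and "\<forall>i\<in>{1..k}. f i \<in> Map_on X"
  shows "\<exists>g :: nat \<Rightarrow> 'x \<Rightarrow> 'a.
           (\<forall>j\<in>{1..n}. g j \<in> fun_space.span (f ` {1..k})) \<and>
           common_zeros X n g = common_zeros X k f"
proof -
  have "card {0, 1 :: 'a} \<le> CARD('a)"
    by (rule card_mono) simp_all
  then have q: "q \<ge> 2"
    using assms(1) by simp
  then have "real (card X) * (real q - 1) \<le> real q ^ (n + 1) - real q"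
    using assms(4) by (simp add: pos_le_divide_eq)
  then have "real (card X * (q - 1) + q) \<le> real (q ^ Suc n)"
    using q by (simp add: of_nat_diff)
  \<comment> \<open>Strictness comes from \<open>q\<close> being at least 2: the summand
    \<open>q\<close> is weakened to 1.\<close>
  then have "card X * (q - 1) + 1 < q ^ Suc n"
    using q by (simp only: of_nat_le_iff)
  then show ?thesis
    using common_zeros_reduce[of X n k f] assms(1,3,5) by (auto simp: image_subset_iff)
qed

end
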